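(* Let $J\subseteq\mathbb{R}$ be an interval, let $f:J\to(0,\infty)$ be a continuous log-convex function, and let $A,B,C,D\in\mathbb{B}(\mathscr{H})_h$ be operators with spectra contained in $J$ such that $A\le m\le B\le M\le D$ and $A\le m\le C\le M\le D$ for real numbers $m<M$. Suppose that one of the following conditions is satisfied: (i) $B+C\le A+D$ and $f(m)\le f(M)$; (ii) $A+D\le B+C$ and $f(M)\le f(m)$. Then \begin{align*} f(B)+f(C)&\le K^{\widetilde{B}}f(m)^{\frac{M-B}{M-m}}f(M)^{\frac{B-m}{M-m}}+K^{\widetilde{C}}f(m)^{\frac{M-C}{M-m}}f(M)^{\frac{C-m}{M-m}}\\ &\le \frac{2M-B-C}{M-m}f(m)+\frac{B+C-2m}{M-m}f(M)\\ &\le K^{\widetilde{A}}f(m)^{\frac{M-A}{M-m}}f(M)^{\frac{A-m}{M-m}}+K^{\widetilde{D}}f(m)^{\frac{M-D}{M-m}}f(M)^{\frac{D-m}{M-m}}\\ &\le f(A)+f(D), \end{align*} where $K=K_f(m,M)=\dfrac{f\left(\frac{m+M}{2}\right)^2}{f(m)f(M)}$ and $\widetilde{t}=\frac12-\frac{1}{M-m}\left|t-\frac{m+M}{2}\right|$.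
   Context: $\mathscr{H}$ is a complex Hilbert space, $\mathbb{B}(\mathscr{H})$ is the algebra of bounded linear operators on $\mathscr{H}$ with identity $I$, and $\mathbb{B}(\mathscr{H})_h$ is its real subspace of self-adjoint operators. For self-adjoint $X,Y$, $X\le Y$ means that $Y-X$ is positive, i.e. $\langle (Y-X)x,x\rangle\ge 0$ for all $x$; a real number $c$ in an operator expression stands for $cI$. A function $f:J\to(0,\infty)$ is log-convex if $\log f$ is convex, i.e. $f(\alpha x+(1-\alpha)y)\le f(x)^{\alpha}f(y)^{1-\alpha}$ for all $x,y\in J$, $\alpha\in[0,1]$. For self-adjoint $X$, all of $f(X)$, $\widetilde{X}=\frac12-\frac1{M-m}\left|X-\frac{m+M}{2}\right|$, and $K^{\widetilde{X}}f(m)^{\frac{M-X}{M-m}}f(M)^{\frac{X-m}{M-m}}$ are defined by the continuous functional calculus of $X$ (the last one is $g(X)$ for the scalar function $g(t)=K^{\widetilde{t}}f(m)^{\frac{M-t}{M-m}}f(M)^{\frac{t-m}{M-m}}$). *)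

theory Defs
  imports "HOL-Analysis.Analysis" "HOL-Computational_Algebra.Polynomial"
begin

text \<open>
  The norm, the topology and the positivity of the complex inner product come from
  \<^class>\<open>real_inner\<close>, because the real part of \<open>cinner\<close> is \<open>inner\<close> and \<open>cinner x x\<close> is real.
  \<open>cinner\<close> is linear in its first argument.
\<close>

class complex_inner = real_inner +
  fixes scaleC :: "complex \<Rightarrow> 'a \<Rightarrow> 'a" (infixr "*\<^sub>C" 75)
    and cinner :: "'a \<Rightarrow> 'a \<Rightarrow> complex"
  assumes scaleC_add_right: "c *\<^sub>C (x + y) = c *\<^sub>C x + c *\<^sub>C y"
    and scaleC_add_left: "(c + d) *\<^sub>C x = c *\<^sub>C x + d *\<^sub>C x"
    and scaleC_scaleC: "c *\<^sub>C (d *\<^sub>C x) = (c * d) *\<^sub>C x"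
    and scaleR_eq_scaleC: "r *\<^sub>R x = complex_of_real r *\<^sub>C x"
    and cinner_commute: "cinner x y = cnj (cinner y x)"
    and cinner_add_left: "cinner (x + y) z = cinner x z + cinner y z"
    and cinner_scaleC_left: "cinner (c *\<^sub>C x) y = c * cinner x y"
    and inner_eq_Re_cinner: "inner x y = Re (cinner x y)"

class complex_hilbert = complex_inner + banach

text \<open>
  \<^typ>\<open>'a \<Rightarrow>\<^sub>L 'a\<close> consists of the bounded real-linear maps; the algebra of bounded operators on
  the complex space is its subset of complex-linear maps.
\<close>

definition clinear_op :: "('a::complex_hilbert \<Rightarrow>\<^sub>L 'a) \<Rightarrow> bool" where
  "clinear_op X \<longleftrightarrow> (\<forall>c x. X (c *\<^sub>C x) = c *\<^sub>C X x)"

definition selfadjoint_op :: "('a::complex_hilbert \<Rightarrow>\<^sub>L 'a) \<Rightarrow> bool" where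
  "selfadjoint_op X \<longleftrightarrow> clinear_op X \<and> (\<forall>x y. cinner (X x) y = cinner x (X y))"

definition positive_op :: "('a::complex_hilbert \<Rightarrow>\<^sub>L 'a) \<Rightarrow> bool" where
  "positive_op X \<longleftrightarrow> clinear_op X \<and> (\<forall>x. cinner (X x) x \<in> \<real> \<and> 0 \<le> Re (cinner (X x) x))"

definition op_le :: "('a::complex_hilbert \<Rightarrow>\<^sub>L 'a) \<Rightarrow> ('a \<Rightarrow>\<^sub>L 'a) \<Rightarrow> bool" (infix "\<preceq>" 50) where
  "X \<preceq> Y \<longleftrightarrow> positive_op (Y - X)"

definition scalar_op :: "real \<Rightarrow> ('a::complex_hilbert \<Rightarrow>\<^sub>L 'a)" where
  "scalar_op c = c *\<^sub>R id_blinfun"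

definition spectrum_op :: "('a::complex_hilbert \<Rightarrow>\<^sub>L 'a) \<Rightarrow> complex set" where
  "spectrum_op X = {z. \<not> (\<exists>S. clinear_op S \<and>
     (\<forall>x. S (X x - z *\<^sub>C x) = x) \<and> (\<forall>x. X (S x) - z *\<^sub>C S x = x))}"

definition poly_op :: "real poly \<Rightarrow> ('a::complex_hilbert \<Rightarrow>\<^sub>L 'a) \<Rightarrow> ('a \<Rightarrow>\<^sub>L 'a)" where
  "poly_op p X = (\<Sum>i\<le>degree p. coeff p i *\<^sub>R ((o\<^sub>L) X ^^ i) id_blinfun)"

text \<open>
  Continuous functional calculus of a self-adjoint operator \<open>X\<close> at a real-valued function \<open>f\<close>
  that is continuous on the spectrum: \<open>f(X)\<close> is the norm limit of \<open>p\<^sub>n(X)\<close> for polynomials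
  \<open>p\<^sub>n\<close> that converge to \<open>f\<close> uniformly on the spectrum of \<open>X\<close>, which is a compact set of reals.
  Real polynomials suffice since \<open>f\<close> is real.
\<close>

definition cfc :: "(real \<Rightarrow> real) \<Rightarrow> ('a::complex_hilbert \<Rightarrow>\<^sub>L 'a) \<Rightarrow> ('a \<Rightarrow>\<^sub>L 'a)" where
  "cfc f X = (THE T. \<exists>p :: nat \<Rightarrow> real poly.
     uniform_limit {t. complex_of_real t \<in> spectrum_op X} (\<lambda>n t. poly (p n) t) f sequentially \<and>
     (\<lambda>n. poly_op (p n) X) \<longlonglongrightarrow> T)"

definition log_convex_on :: "real set \<Rightarrow> (real \<Rightarrow> real) \<Rightarrow> bool" where
  "log_convex_on J f \<longleftrightarrow> (\<forall>x\<in>J. 0 < f x) \<and> convex_on J (\<lambda>x. ln (f x))"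

definition kant :: "(real \<Rightarrow> real) \<Rightarrow> real \<Rightarrow> real \<Rightarrow> real" where
  "kant f m M = (f ((m + M) / 2))\<^sup>2 / (f m * f M)"

definition tilde :: "real \<Rightarrow> real \<Rightarrow> real \<Rightarrow> real" where
  "tilde m M t = 1 / 2 - 1 / (M - m) * \<bar>t - (m + M) / 2\<bar>"

definition refined_chord :: "(real \<Rightarrow> real) \<Rightarrow> real \<Rightarrow> real \<Rightarrow> real \<Rightarrow> real" where
  "refined_chord f m M t =
     kant f m M powr tilde m M t * f m powr ((M - t) / (M - m)) * f M powr ((t - m) / (M - m))"

end

theory Submission
  imports Defs "HOL-Computational_Algebra.Fundamental_Theorem_Algebra"
begin

text \<open>
  Write \<open>L\<close> for the chord of \<open>f\<close> through \<open>m\<close> and \<open>M\<close>, and \<open>R\<close> for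
  \<^term>\<open>refined_chord f m M\<close>. The function \<open>ln R\<close> is piecewise linear: on either side of the midpoint
  \<open>c\<close> of \<open>m\<close> and \<open>M\<close> it is the line through the points of the graph of \<open>ln f\<close> over \<open>c\<close> and over the
  endpoint on that side. A convex function lies below its chords between their endpoints and above their
  prolongations, so \<open>f \<le> R\<close> on \<open>[m, M]\<close> and \<open>R \<le> f\<close> on the rest of \<open>J\<close>. Moreover \<open>R\<close> is the exponential of the
  chord of \<open>ln f\<close> times \<open>K\<close> to the power \<open>tilde m M t\<close>; here \<open>K \<le> 1\<close>, the exponent is nonnegative
  on \<open>[m, M]\<close> and nonpositive outside, and the exponential of a linear function is convex. Hence
  \<open>R \<le> L\<close> on \<open>[m, M]\<close> and \<open>L \<le> R\<close> outside.

  The order hypotheses put the spectra of \<open>B\<close> and \<open>C\<close> inside \<open>[m, M]\<close>, that of \<open>A\<close> to the left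
  of \<open>m\<close> and that of \<open>D\<close> to the right of \<open>M\<close>. As the functional calculus is monotone
  (\<open>cfc_mono\<close>), the scalar inequalities give every operator inequality except
  \<open>L(B) + L(C) \<le> L(A) + L(D)\<close>. Since \<open>L\<close> is affine, the difference of the two sides is the slope of \<open>L\<close> times
  \<open>A + D - B - C\<close>, and either alternative of the last hypothesis makes these two factors have equal sign.

  The monotonicity of the functional calculus rests on one fact (\<open>poly_op_nonneg\<close>): a polynomial \<open>p\<close> that is
  nonnegative on the spectrum of a self-adjoint \<open>X\<close> has \<open>p(X) \<ge> 0\<close>. Let \<open>a\<close> be the infimum of the numerical
  range of \<open>p(X)\<close>. Then \<open>p(X) - a\<close> is not bounded below. A real polynomial without zeros on the
  spectrum gives an operator bounded below, because its linear factors do by the description of the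
  spectrum (\<open>real_spectrum_iff\<close>) and its quadratic factors \<open>(t - u)\<^sup>2 + v\<^sup>2\<close> do because the square of a
  self-adjoint operator is positive. So \<open>p - a\<close> has a zero on the spectrum, and \<open>a \<ge> 0\<close>.
  Applied to \<open>e\<^sup>2 - p\<^sup>2\<close>, the same fact bounds the norm of \<open>p(X)\<close>, whence the limits that define
  the calculus exist and are unique.
\<close>

section \<open>Self-adjoint operators and their quadratic forms\<close>

lemma cinner_scaleC_right: "cinner x (c *\<^sub>C y) = cnj c * cinner x (y::'a::complex_inner)"
  by (metis cinner_commute cinner_scaleC_left complex_cnj_mult complex_cnj_cnj)

text \<open>The complex inner product inherits its continuity from the real one through its real and
  imaginary parts.\<close>

lemma cinner_eq_Complex:
  "cinner x y = Complex (inner x y) (inner x (\<i> *\<^sub>C (y::'a::complex_inner)))"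
  by (rule complex_eqI) (simp_all add: inner_eq_Re_cinner cinner_scaleC_right)

lemma tendsto_cinner_left:
  assumes "(u \<longlongrightarrow> (x::'a::complex_inner)) F"
  shows "((\<lambda>n. cinner (u n) y) \<longlongrightarrow> cinner x y) F"
  unfolding cinner_eq_Complex by (intro tendsto_Complex tendsto_inner assms tendsto_const)

lemma tendsto_cinner_right:
  assumes "(u \<longlongrightarrow> (x::'a::complex_inner)) F"
  shows "((\<lambda>n. cinner y (u n)) \<longlongrightarrow> cinner y x) F"
  using tendsto_cnj[OF tendsto_cinner_left[OF assms, of y]] by (simp add: cinner_commute[symmetric])

lemma cinner_add_right: "cinner x (y + z) = cinner x y + cinner x (z::'a::complex_inner)"
  by (metis cinner_add_left cinner_commute complex_cnj_add)

lemma cinner_ext: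
  assumes "\<And>z. cinner x z = cinner y (z::'a::complex_inner)"
  shows "x = y"
proof -
  have "inner x (x - y) = inner y (x - y)"
    using assms[of "x - y"] by (simp only: inner_eq_Re_cinner)
  then have "inner (x - y) (x - y) = 0"
    by (simp only: inner_diff_left)
  then show ?thesis by simp
qed

text \<open>Complex linearity is automatic for a symmetric map, as both sides have the same inner
  product with every vector. Closure properties of self-adjointness therefore only concern the inner product.\<close>

lemma selfadjoint_iff_cinner: "selfadjoint_op X \<longleftrightarrow> (\<forall>x y. cinner (X x) y = cinner x (X y))"
proof
  assume *: "\<forall>x y. cinner (X x) y = cinner x (X y)"
  have "X (c *\<^sub>C x) = c *\<^sub>C X x" for c x
    by (rule cinner_ext) (simp add: * cinner_scaleC_left)
  then show "selfadjoint_op X"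
    using * by (simp add: selfadjoint_op_def clinear_op_def)
qed (simp add: selfadjoint_op_def)

lemma selfadjoint_inner: "selfadjoint_op X \<Longrightarrow> inner (X x) y = inner x (X y)"
  by (simp add: selfadjoint_iff_cinner inner_eq_Re_cinner)

lemma selfadjoint_scaleC: "selfadjoint_op X \<Longrightarrow> X (c *\<^sub>C x) = c *\<^sub>C X x"
  by (simp add: selfadjoint_op_def clinear_op_def)

lemma selfadjoint_add: "selfadjoint_op X \<Longrightarrow> selfadjoint_op Y \<Longrightarrow> selfadjoint_op (X + Y)"
  by (simp add: selfadjoint_iff_cinner blinfun.add_left cinner_add_left cinner_add_right)

lemma selfadjoint_scaleR: "selfadjoint_op X \<Longrightarrow> selfadjoint_op (r *\<^sub>R X)"
  by (simp add: selfadjoint_iff_cinner blinfun.scaleR_left scaleR_eq_scaleC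
      cinner_scaleC_left cinner_scaleC_right)

lemma selfadjoint_diff: "selfadjoint_op X \<Longrightarrow> selfadjoint_op Y \<Longrightarrow> selfadjoint_op (X - Y)"
  using selfadjoint_add[of X "(-1) *\<^sub>R Y"] selfadjoint_scaleR[of Y "-1"] by simp

lemma selfadjoint_scalar_op: "selfadjoint_op (scalar_op c)"
  unfolding scalar_op_def by (rule selfadjoint_scaleR) (simp add: selfadjoint_iff_cinner)

lemma selfadjoint_lim:
  assumes "P \<longlonglongrightarrow> T" "\<And>n. selfadjoint_op (P n)"
  shows "selfadjoint_op T"
  unfolding selfadjoint_iff_cinner
proof (intro allI)
  fix x y
  have ev: "(\<lambda>n. P n z) \<longlonglongrightarrow> T z" for z
    by (intro blinfun.tendsto assms tendsto_const)
  have "(\<lambda>n. cinner (P n x) y) \<longlonglongrightarrow> cinner x (T y)"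
    using tendsto_cinner_right[OF ev] assms(2) by (simp add: selfadjoint_iff_cinner)
  then show "cinner (T x) y = cinner x (T y)"
    using tendsto_cinner_left[OF ev] LIMSEQ_unique by blast
qed

text \<open>For a self-adjoint operator the complex quadratic form is real, so that the whole argument can be
  carried out with the real inner product.\<close>

lemma positive_op_iff:
  assumes "selfadjoint_op X"
  shows "positive_op X \<longleftrightarrow> (\<forall>x. 0 \<le> inner (X x) x)"
proof -
  have "cinner (X x) x \<in> \<real>" for x
    using assms cinner_commute[of "X x" x]
    by (metis selfadjoint_iff_cinner Reals_cnj_iff)
  then show ?thesis
    using assms by (simp add: positive_op_def selfadjoint_op_def inner_eq_Re_cinner)
qed

lemma op_le_iff:
  assumes "selfadjoint_op X" "selfadjoint_op Y"
  shows "X \<preceq> Y \<longleftrightarrow> (\<forall>x. inner (X x) x \<le> inner (Y x) x)"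
  by (simp add: op_le_def positive_op_iff selfadjoint_diff assms blinfun.diff_left inner_diff_left)

lemma scalar_op_apply [simp]: "scalar_op c x = c *\<^sub>R x"
  by (simp add: scalar_op_def blinfun.scaleR_left)

section \<open>The spectrum as the failure of bounded invertibility\<close>

text \<open>For self-adjoint operators being bounded below is the same as being invertible
  (\<open>symmetric_bounded_below_surj\<close>), and it is easier to handle: it passes to
  products and follows from a lower bound of the quadratic form.\<close>

definition bounded_below :: "('a::real_normed_vector \<Rightarrow> 'a) \<Rightarrow> bool" where
  "bounded_below T \<longleftrightarrow> (\<exists>c>0. \<forall>x. c * norm x \<le> norm (T x))"

lemma bounded_belowI: "0 < c \<Longrightarrow> (\<And>x. c * norm x \<le> norm (T x)) \<Longrightarrow> bounded_below T"
  by (auto simp: bounded_below_def)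

lemma bounded_below_comp:
  assumes "bounded_below S" "bounded_below T"
  shows "bounded_below (\<lambda>x. S (T x))"
proof -
  obtain c d where cd: "c > 0" "\<And>x. c * norm x \<le> norm (S x)" "d > 0" "\<And>x. d * norm x \<le> norm (T x)"
    using assms unfolding bounded_below_def by blast
  show ?thesis
  proof (rule bounded_belowI)
    fix x
    have "c * (d * norm x) \<le> c * norm (T x)" using cd by simp
    also have "\<dots> \<le> norm (S (T x))" using cd by simp
    finally show "(c * d) * norm x \<le> norm (S (T x))" by simp
  qed (use cd in simp)
qed

lemma bounded_below_of_form:
  assumes "0 < c" "\<And>x. c * (norm x)\<^sup>2 \<le> inner (T x) (x::'a::real_inner)"
  shows "bounded_below T"
proof (rule bounded_belowI[OF \<open>0 < c\<close>])
  fix x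
  have "c * norm x * norm x \<le> norm (T x) * norm x"
    using assms(2)[of x] norm_cauchy_schwarz[of "T x" x] by (simp add: power2_eq_square)
  then show "c * norm x \<le> norm (T x)"
    by (cases "x = 0") simp_all
qed

text \<open>The operator \<open>Y\<^sup>2\<close> is coercive, since \<open>\<langle>Y\<^sup>2 x, x\<rangle>\<close> is the
  square of the norm of \<open>Y x\<close>. Hence for a small step \<open>s\<close> the map \<open>x \<mapsto> x - s (Y\<^sup>2 x - y)\<close> is a contraction; its
  fixed point solves \<open>Y (Y x) = y\<close>.\<close>

lemma symmetric_bounded_below_surj:
  fixes Y :: "'a::{real_inner, banach} \<Rightarrow>\<^sub>L 'a"
  assumes sym: "\<And>x y. inner (Y x) y = inner x (Y y)" and "bounded_below Y"
  shows "\<exists>x. Y x = y"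
proof -
  obtain c where c: "c > 0" "\<And>x. c * norm x \<le> norm (Y x)"
    using assms(2) unfolding bounded_below_def by blast
  define N where "N = norm Y + c"
  have N: "N > 0" "c \<le> N" "\<And>x. norm (Y x) \<le> N * norm x"
    using c(1) by (auto simp: N_def add_nonneg_pos distrib_right
      intro: order_trans[OF norm_blinfun] add_increasing2)
  \<comment> \<open>this step minimises the bound \<open>1 - 2 s c\<^sup>2 + s\<^sup>2 N\<^sup>4\<close> for the squared contraction factor\<close>
  define s where "s = c\<^sup>2 / N ^ 4"
  define q where "q = 1 - c ^ 4 / N ^ 4"
  have q: "0 \<le> q" "q < 1"
    using c(1) N by (auto simp: q_def power_mono)
  have contr: "norm (x - s *\<^sub>R Y (Y x)) \<le> sqrt q * norm x" for x
  proof -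
    have "norm (Y (Y x)) \<le> N * (N * norm x)"
      using N by (meson order_trans mult_left_mono less_imp_le)
    then have "(norm (Y (Y x)))\<^sup>2 \<le> (N * (N * norm x))\<^sup>2"
      by (intro power_mono) auto
    then have 1: "s\<^sup>2 * (norm (Y (Y x)))\<^sup>2 \<le> s\<^sup>2 * (N ^ 4 * (norm x)\<^sup>2)"
      by (intro mult_left_mono) (simp_all add: power_mult_distrib eval_nat_numeral mult_ac)
    have "(c * norm x)\<^sup>2 \<le> (norm (Y x))\<^sup>2"
      using c by (intro power_mono) auto
    then have 2: "s * (c\<^sup>2 * (norm x)\<^sup>2) \<le> s * (norm (Y x))\<^sup>2"
      by (intro mult_left_mono) (simp_all add: power_mult_distrib s_def)
    have "(norm (x - s *\<^sub>R Y (Y x)))\<^sup>2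
        = (norm x)\<^sup>2 - 2 * (s * (norm (Y x))\<^sup>2) + s\<^sup>2 * (norm (Y (Y x)))\<^sup>2"
      using sym[of x "Y x"] unfolding power2_norm_eq_inner power2_eq_square[of s]
      by (simp add: inner_diff_left inner_diff_right inner_commute algebra_simps)
    also have "\<dots> \<le> (norm x)\<^sup>2 - 2 * (s * (c\<^sup>2 * (norm x)\<^sup>2)) + s\<^sup>2 * (N ^ 4 * (norm x)\<^sup>2)"
      using 1 2 by linarith
    also have "\<dots> = q * (norm x)\<^sup>2"
      using N(1) by (simp add: s_def q_def field_simps power2_eq_square eval_nat_numeral)
    finally have "norm (x - s *\<^sub>R Y (Y x)) \<le> sqrt (q * (norm x)\<^sup>2)"
      by (simp add: real_le_rsqrt)
    then show ?thesis by (simp add: real_sqrt_mult)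
  qed
  define g where "g x = x - s *\<^sub>R (Y (Y x) - y)" for x
  have "dist (g x) (g z) \<le> sqrt q * dist x z" for x z
    using contr[of "x - z"] by (simp add: g_def dist_norm blinfun.diff_right algebra_simps)
  then have "\<exists>!x. g x = x"
    using q by (intro banach_fix_type[of "sqrt q"]) auto
  then obtain x where "g x = x" by blast
  then have "Y (Y x) = y"
    using c N by (simp add: g_def s_def)
  then show ?thesis by blast
qed

definition real_spectrum :: "('a::complex_hilbert \<Rightarrow>\<^sub>L 'a) \<Rightarrow> real set" where
  "real_spectrum X = {t. complex_of_real t \<in> spectrum_op X}"

text \<open>A lower bound makes \<open>X - t\<close> injective with bounded inverse on its range, which is everything by
  \<open>symmetric_bounded_below_surj\<close>. Conversely a bounded inverse yields a lower bound.\<close>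

lemma real_spectrum_iff:
  assumes X: "selfadjoint_op X"
  shows "t \<in> real_spectrum X \<longleftrightarrow> \<not> bounded_below (\<lambda>x. X x - t *\<^sub>R x)"
proof
  assume t: "t \<in> real_spectrum X"
  show "\<not> bounded_below (\<lambda>x. X x - t *\<^sub>R x)"
  proof
    assume bb: "bounded_below (\<lambda>x. X x - t *\<^sub>R x)"
    define Y where "Y = X - scalar_op t"
    have Y: "selfadjoint_op Y" and Yx: "\<And>x. Y x = X x - t *\<^sub>R x"
      by (simp_all add: Y_def X selfadjoint_diff selfadjoint_scalar_op blinfun.diff_left)
    obtain c where c: "c > 0" "\<And>x. c * norm x \<le> norm (Y x)"
      using bb unfolding bounded_below_def Yx[symmetric] by blast
    have inj: "x = z" if "Y x = Y z" for x z
    proof -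
      have "c * norm (x - z) \<le> 0"
        using c(2)[of "x - z"] that by (simp add: blinfun.diff_right)
      then show ?thesis using c(1) by (simp add: mult_le_0_iff)
    qed
    have "bounded_below Y" using bb by (simp add: bounded_below_def Yx)
    then have "\<exists>x. Y x = y" for y
      by (intro symmetric_bounded_below_surj selfadjoint_inner Y)
    then obtain S where S: "\<And>y. Y (S y) = y" by metis
    have "bounded_linear S"
    proof (rule bounded_linear_intro)
      show "S (x + y) = S x + S y" for x y
        by (rule inj) (simp add: S blinfun.add_right)
      show "S (r *\<^sub>R x) = r *\<^sub>R S x" for r x
        by (rule inj) (simp add: S blinfun.scaleR_right)
      show "norm (S x) \<le> norm x * (1 / c)" for x
        using c(2)[of "S x"] c(1) by (simp add: S field_simps)
    qed
    then have B: "blinfun_apply (Blinfun S) = S" by (rule bounded_linear_Blinfun_apply)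
    have "clinear_op (Blinfun S)"
      unfolding clinear_op_def B
    proof (intro allI)
      show "S (a *\<^sub>C x) = a *\<^sub>C S x" for a x
        by (rule inj) (simp add: S selfadjoint_scaleC[OF Y])
    qed
    moreover have "S (Y x) = x" for x by (rule inj) (simp add: S)
    ultimately have "complex_of_real t \<notin> spectrum_op X"
      using S unfolding spectrum_op_def scaleR_eq_scaleC[symmetric] mem_Collect_eq not_not
      by (intro exI[of _ "Blinfun S"]) (auto simp: B Yx)
    then show False using t by (simp add: real_spectrum_def)
  qed
next
  assume nb: "\<not> bounded_below (\<lambda>x. X x - t *\<^sub>R x)"
  show "t \<in> real_spectrum X"
  proof (rule ccontr)
    assume "t \<notin> real_spectrum X"
    then obtain S where S: "\<And>x. blinfun_apply S (X x - t *\<^sub>R x) = x"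
      by (auto simp: real_spectrum_def spectrum_op_def scaleR_eq_scaleC)
    have "bounded_below (\<lambda>x. X x - t *\<^sub>R x)"
    proof (rule bounded_belowI)
      show "1 / (norm S + 1) * norm x \<le> norm (X x - t *\<^sub>R x)" for x
      proof -
        have "norm x \<le> norm S * norm (X x - t *\<^sub>R x)"
          using norm_blinfun[of S "X x - t *\<^sub>R x"] by (simp add: S)
        also have "\<dots> \<le> (norm S + 1) * norm (X x - t *\<^sub>R x)"
          by (simp add: mult_right_mono)
        finally show ?thesis
          by (simp add: divide_simps add_nonneg_pos mult.commute add_nonneg_eq_0_iff)
      qed
    qed (simp add: add_nonneg_pos)
    with nb show False by simp
  qed
qed

lemma real_spectrum_le:
  assumes X: "selfadjoint_op X" and le: "X \<preceq> scalar_op m" and t: "t \<in> real_spectrum X"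
  shows "t \<le> m"
proof (rule ccontr)
  assume "\<not> t \<le> m"
  have "bounded_below (\<lambda>x. - (X x - t *\<^sub>R x))"
  proof (rule bounded_below_of_form)
    show "(t - m) * (norm x)\<^sup>2 \<le> inner (- (X x - t *\<^sub>R x)) x" for x
      using le by (simp add: op_le_iff X selfadjoint_scalar_op inner_diff_left power2_norm_eq_inner
          algebra_simps)
  qed (use \<open>\<not> t \<le> m\<close> in simp)
  then have "bounded_below (\<lambda>x. X x - t *\<^sub>R x)"
    by (simp add: bounded_below_def norm_minus_commute)
  with t show False by (simp add: real_spectrum_iff X)
qed

lemma real_spectrum_ge:
  assumes X: "selfadjoint_op X" and le: "scalar_op m \<preceq> X" and t: "t \<in> real_spectrum X"
  shows "m \<le> t"
proof (rule ccontr)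
  assume "\<not> m \<le> t"
  have "bounded_below (\<lambda>x. X x - t *\<^sub>R x)"
  proof (rule bounded_below_of_form)
    show "(m - t) * (norm x)\<^sup>2 \<le> inner (X x - t *\<^sub>R x) x" for x
      using le by (simp add: op_le_iff X selfadjoint_scalar_op inner_diff_left power2_norm_eq_inner
          algebra_simps)
  qed (use \<open>\<not> m \<le> t\<close> in simp)
  with t show False by (simp add: real_spectrum_iff X)
qed

text \<open>The quadratic form bounds the spectrum by the norm, and a lower bound \<open>c\<close> of \<open>X - t\<close>
  survives, up to a factor \<open>1/2\<close>, a perturbation of \<open>t\<close> by less than \<open>c / 2\<close>.\<close>

lemma compact_real_spectrum:
  assumes X: "selfadjoint_op X"
  shows "compact (real_spectrum X)"
proof -
  have form: "\<bar>inner (X x) x\<bar> \<le> norm X * inner x x" for x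
  proof -
    have "\<bar>inner (X x) x\<bar> \<le> norm (X x) * norm x" by (rule Cauchy_Schwarz_ineq2)
    also have "\<dots> \<le> norm X * norm x * norm x" by (intro mult_right_mono norm_blinfun) simp
    finally show ?thesis by (simp add: power2_norm_eq_inner[symmetric] power2_eq_square)
  qed
  have "X \<preceq> scalar_op (norm X)" "scalar_op (- norm X) \<preceq> X"
    using form by (auto simp: op_le_iff X selfadjoint_scalar_op abs_le_iff minus_le_iff)
  then have "real_spectrum X \<subseteq> {- norm X..norm X}"
    using real_spectrum_le[OF X] real_spectrum_ge[OF X] by auto
  then have "bounded (real_spectrum X)"
    by (rule bounded_subset[rotated]) simp
  moreover have "closed (real_spectrum X)"
    unfolding closed_def open_dist
  proof (intro ballI)
    fix t assume "t \<in> - real_spectrum X"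
    then obtain c where c: "c > 0" "\<And>x. c * norm x \<le> norm (X x - t *\<^sub>R x)"
      by (auto simp: real_spectrum_iff X bounded_below_def)
    have "s \<notin> real_spectrum X" if s: "dist s t < c / 2" for s
    proof -
      have "bounded_below (\<lambda>x. X x - s *\<^sub>R x)"
      proof (rule bounded_belowI)
        fix x
        have "norm (X x - t *\<^sub>R x) \<le> norm (X x - s *\<^sub>R x) + norm ((s - t) *\<^sub>R x)"
          using norm_triangle_ineq[of "X x - s *\<^sub>R x" "(s - t) *\<^sub>R x"] by (simp add: algebra_simps)
        moreover have "norm ((s - t) *\<^sub>R x) \<le> c / 2 * norm x"
          using s by (simp add: dist_real_def mult_right_mono del: times_divide_eq_left)
        ultimately show "c / 2 * norm x \<le> norm (X x - s *\<^sub>R x)"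
          using c(2)[of x] by simp
      qed (use c in simp)
      then show ?thesis by (simp add: real_spectrum_iff X)
    qed
    then show "\<exists>e>0. \<forall>s. dist s t < e \<longrightarrow> s \<in> - real_spectrum X"
      using c(1) by (intro exI[of _ "c / 2"]) auto
  qed
  ultimately show ?thesis by (simp add: compact_eq_bounded_closed)
qed

text \<open>The infimum \<open>a\<close> of the numerical range is an approximate eigenvalue. Put \<open>P = Y - a\<close>, which is
  positive. The Cauchy-Schwarz inequality for the form of \<open>P\<close>, applied to \<open>x\<close> and \<open>P x\<close>,
  bounds the square of the norm of \<open>P x\<close> by a multiple of
  \<open>\<langle>P x, x\<rangle>\<close>. If \<open>P\<close> were bounded below, its form would thus exceed a positive
  constant on unit vectors, against the choice of \<open>a\<close>.\<close>

lemma symmetric_form_infimum: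
  fixes Y :: "'a::real_inner \<Rightarrow>\<^sub>L 'a"
  assumes sym: "\<And>x y. inner (Y x) y = inner x (Y y)" and ne: "(x0::'a) \<noteq> 0"
  obtains a where "\<And>x. a * (norm x)\<^sup>2 \<le> inner (Y x) x" "\<not> bounded_below (\<lambda>x. Y x - a *\<^sub>R x)"
proof -
  define W where "W = {r. \<exists>x. norm x = 1 \<and> r = inner (Y x) x}"
  define a where "a = Inf W"
  have "inner (Y (sgn x0)) (sgn x0) \<in> W"
    using ne by (auto simp: W_def norm_sgn intro!: exI[of _ "sgn x0"])
  then have Wne: "W \<noteq> {}" by blast
  have "- norm Y \<le> r" if r: "r \<in> W" for r
  proof -
    obtain x where "norm x = 1" "r = inner (Y x) x" using r by (auto simp: W_def)
    then show ?thesis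
      using Cauchy_Schwarz_ineq2[of "Y x" x] norm_blinfun[of Y x] by simp
  qed
  then have Wb: "bdd_below W" by (rule bdd_belowI)
  have scale: "b * (norm x)\<^sup>2 \<le> inner (Y x) x"
    if b: "\<And>r. r \<in> W \<Longrightarrow> b \<le> r" for b x
  proof (cases "x = 0")
    case False
    have "inner (Y (sgn x)) (sgn x) \<in> W"
      unfolding W_def using False by (intro CollectI exI[of _ "sgn x"]) (simp add: norm_sgn)
    then have "b \<le> inner (Y (sgn x)) (sgn x)" by (rule b)
    also have "\<dots> = inner (Y x) x / (norm x)\<^sup>2"
      by (simp add: sgn_div_norm blinfun.scaleR_right power2_eq_square divide_simps)
    finally show ?thesis using False by (simp add: field_simps)
  qed simp
  have lower: "a * (norm x)\<^sup>2 \<le> inner (Y x) x" for x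
    by (rule scale) (simp add: a_def cInf_lower Wb)
  moreover have "\<not> bounded_below (\<lambda>x. Y x - a *\<^sub>R x)"
  proof
    assume "bounded_below (\<lambda>x. Y x - a *\<^sub>R x)"
    define P where "P = Y - a *\<^sub>R id_blinfun"
    have Px: "P x = Y x - a *\<^sub>R x" for x
      by (simp add: P_def blinfun.diff_left blinfun.scaleR_left)
    have Psym: "inner (P x) y = inner x (P y)" for x y
      by (simp add: Px inner_diff_left inner_diff_right sym)
    have Ppos: "0 \<le> inner (P x) x" for x
      using lower[of x] by (simp add: Px inner_diff_left power2_norm_eq_inner)
    obtain c where c: "c > 0" "\<And>x. c * norm x \<le> norm (P x)"
      using \<open>bounded_below _\<close> unfolding bounded_below_def Px[symmetric] by blast
    define N where "N = norm P + 1"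
    have N: "N > 0" "\<And>x. norm (P x) \<le> N * norm x"
      by (auto simp: N_def add_nonneg_pos distrib_right intro: order_trans[OF norm_blinfun])
    have key: "(norm (P x))\<^sup>2 \<le> N * inner (P x) x" for x
    proof -
      define s where "s = 1 / N"
      have "inner (P (P x)) (P x) \<le> norm (P (P x)) * norm (P x)"
        by (rule norm_cauchy_schwarz)
      also have "\<dots> \<le> N * norm (P x) * norm (P x)"
        by (intro mult_right_mono N) simp
      finally have "s\<^sup>2 * inner (P (P x)) (P x) \<le> s\<^sup>2 * (N * (norm (P x))\<^sup>2)"
        by (intro mult_left_mono) (simp_all add: power2_eq_square)
      also have "\<dots> = s * (norm (P x))\<^sup>2"
        using N(1) by (simp add: s_def power2_eq_square)
      finally have 1: "s\<^sup>2 * inner (P (P x)) (P x) \<le> s * (norm (P x))\<^sup>2" .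
      \<comment> \<open>positivity at \<open>x - s P x\<close> is the instance of Cauchy-Schwarz needed; \<open>s = 1 / N\<close> absorbs the quadratic term\<close>
      have "0 \<le> inner (P (x - s *\<^sub>R P x)) (x - s *\<^sub>R P x)" by (rule Ppos)
      also have "\<dots> = inner (P x) x - 2 * (s * (norm (P x))\<^sup>2) + s\<^sup>2 * inner (P (P x)) (P x)"
        using Psym[of "P x" x] unfolding power2_norm_eq_inner power2_eq_square[of s]
        by (simp add: blinfun.diff_right blinfun.scaleR_right inner_diff_left inner_diff_right
          algebra_simps)
      finally have "s * (norm (P x))\<^sup>2 \<le> inner (P x) x" using 1 by linarith
      then show ?thesis using N(1) by (simp add: s_def field_simps)
    qed
    have "a + c\<^sup>2 / N \<le> Inf W"
    proof (rule cInf_greatest[OF Wne])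
      fix r assume "r \<in> W"
      then obtain x where x: "norm x = 1" "r = inner (Y x) x" by (auto simp: W_def)
      have "c\<^sup>2 \<le> (norm (P x))\<^sup>2"
        using c(1) c(2)[of x] x(1) by (intro power_mono) auto
      also have "\<dots> \<le> N * inner (P x) x" by (rule key)
      also have "inner (P x) x = r - a"
        using x by (simp add: Px inner_diff_left power2_norm_eq_inner[symmetric])
      finally show "a + c\<^sup>2 / N \<le> r" using N(1) by (simp add: field_simps)
    qed
    then have "c\<^sup>2 / N \<le> 0" by (simp add: a_def)
    then show False using c(1) N(1) by (simp add: divide_le_0_iff)
  qed
  ultimately show thesis by (rule that)
qed

lemma real_spectrum_nonempty:
  fixes X :: "'a::complex_hilbert \<Rightarrow>\<^sub>L 'a"
  assumes "selfadjoint_op X" "(x0::'a) \<noteq> 0"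
  shows "real_spectrum X \<noteq> {}"
  using symmetric_form_infimum[of X x0] assms
  by (metis empty_iff real_spectrum_iff selfadjoint_inner)

section \<open>Positive polynomials of an operator\<close>

lemma poly_op_eq_sum:
  assumes "degree p \<le> n"
  shows "poly_op p X = (\<Sum>i\<le>n. coeff p i *\<^sub>R ((o\<^sub>L) X ^^ i) id_blinfun)"
  unfolding poly_op_def
  by (rule sum.mono_neutral_left) (use assms in \<open>auto simp: coeff_eq_0\<close>)

lemma poly_op_0 [simp]: "poly_op 0 X = 0"
  by (simp add: poly_op_def)

lemma poly_op_pCons [simp]: "poly_op (pCons a p) X x = a *\<^sub>R x + X (poly_op p X x)"
proof -
  have "poly_op (pCons a p) X
      = (\<Sum>i\<le>Suc (degree p). coeff (pCons a p) i *\<^sub>R ((o\<^sub>L) X ^^ i) id_blinfun)"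
    by (rule poly_op_eq_sum) (simp add: degree_pCons_le)
  then show ?thesis
    by (simp add: sum.atMost_Suc_shift poly_op_def blinfun.add_left blinfun.sum_left
        blinfun.scaleR_left blinfun.sum_right blinfun.scaleR_right del: sum.atMost_Suc)
qed

lemma poly_op_add [simp]: "poly_op (p + q) X x = poly_op p X x + poly_op q X x"
  by (induction p q arbitrary: x rule: poly_induct2)
    (simp_all add: algebra_simps blinfun.add_right)

lemma poly_op_smult [simp]: "poly_op (smult c p) X x = c *\<^sub>R poly_op p X x"
  by (induction p arbitrary: x)
    (simp_all add: algebra_simps blinfun.scaleR_right)

lemma poly_op_diff [simp]: "poly_op (p - q) X x = poly_op p X x - poly_op q X x"
  using poly_op_add[of p "- q" X x] poly_op_smult[of "-1" q X x] by simp

text \<open>With \<open>poly_op_add\<close> this makes \<open>p \<mapsto> p(X)\<close> a ring homomorphism; the commutation of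
  \<open>X\<close> with \<open>p(X)\<close>, and hence the self-adjointness of \<open>p(X)\<close>, come from the commutativity of polynomials.\<close>

lemma poly_op_mult [simp]: "poly_op (p * q) X x = poly_op p X (poly_op q X x)"
  by (induction p arbitrary: x) (simp_all)

lemma selfadjoint_poly_op:
  assumes "selfadjoint_op X"
  shows "selfadjoint_op (poly_op p X)"
proof (induction p)
  case 0
  then show ?case using selfadjoint_scaleR[OF assms, of 0] by simp
next
  case (pCons a p)
  have "poly_op p X (X x) = X (poly_op p X x)" for x
    using poly_op_mult[of p "[:0, 1:]" X x] poly_op_mult[of "[:0, 1:]" p X x]
    by (simp add: mult.commute)
  then show ?case
    using pCons assms
    by (simp add: selfadjoint_iff_cinner cinner_add_left cinner_add_right scaleR_eq_scaleC
      cinner_scaleC_left cinner_scaleC_right)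
qed

lemma poly_of_real_add:
  "poly (map_poly complex_of_real (p + q)) z
     = poly (map_poly complex_of_real p) z + poly (map_poly complex_of_real q) z"
  by (induction p q rule: poly_induct2) (simp_all add: map_poly_pCons algebra_simps)

lemma poly_of_real_smult:
  "poly (map_poly complex_of_real (smult c p)) z = c * poly (map_poly complex_of_real p) z"
  by (induction p) (simp_all add: map_poly_pCons algebra_simps)

lemma poly_of_real_mult:
  "poly (map_poly complex_of_real (p * q)) z
     = poly (map_poly complex_of_real p) z * poly (map_poly complex_of_real q) z"
  by (induction p)
    (simp_all add: map_poly_pCons algebra_simps poly_of_real_add poly_of_real_smult)

lemma poly_of_real_eval:
  "poly (map_poly complex_of_real p) (complex_of_real t) = complex_of_real (poly p t)"
  by (induction p) (simp_all add: map_poly_pCons)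

text \<open>A complex root of \<open>q\<close> is either real or is a root of a real quadratic \<open>d\<close>. In the second
  case the remainder of \<open>q\<close> modulo \<open>d\<close> is a real polynomial of degree at most one with a non-real root, so it vanishes.\<close>

lemma real_poly_root_or_quadratic_factor:
  fixes q :: "real poly"
  assumes "degree q > 0"
  obtains t where "[:- t, 1:] dvd q"
  | u v where "v \<noteq> 0" "[:u\<^sup>2 + v\<^sup>2, - 2 * u, 1:] dvd q"
proof -
  let ?e = "\<lambda>p. poly (map_poly complex_of_real p)"
  have "degree (map_poly complex_of_real q) > 0"
    using assms by (simp add: degree_map_poly)
  then obtain z where z: "?e q z = 0"
    using fundamental_theorem_of_algebra constant_degree by (metis less_numeral_extra(3))
  show thesis
  proof (cases "Im z = 0")
    case True
    then have "z = complex_of_real (Re z)" by (simp add: complex_eq_iff)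
    then have "poly q (Re z) = 0"
      using z poly_of_real_eval by (metis of_real_eq_0_iff)
    then show thesis
      using that(1) by (simp add: poly_eq_0_iff_dvd)
  next
    case False
    define d where "d = [:(Re z)\<^sup>2 + (Im z)\<^sup>2, - 2 * Re z, 1:]"
    have dz: "?e d z = 0"
      by (simp add: d_def map_poly_pCons complex_eq_iff power2_eq_square algebra_simps)
    have "?e q z = ?e (q div d) z * ?e d z + ?e (q mod d) z"
      by (metis poly_of_real_add poly_of_real_mult div_mult_mod_eq)
    then have rz: "?e (q mod d) z = 0" using z dz by simp
    have "degree (q mod d) < 2"
      using degree_mod_less[of d q] by (auto simp: d_def)
    then obtain a b where ab: "q mod d = [:a, b:]"
      by (metis degree_eq_zeroE degree1_coeffs less_2_cases One_nat_def pCons_0_0)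
    then have "b * Im z = 0" "a + b * Re z = 0"
      using rz by (auto simp: map_poly_pCons complex_eq_iff algebra_simps)
    then have "q mod d = 0" using False ab by simp
    then have "d dvd q" by (simp add: dvd_eq_mod_eq_0)
    then show thesis using that(2)[of "Im z" "Re z"] False by (simp add: d_def)
  qed
qed

text \<open>A linear factor is bounded below as its root lies off the spectrum, and a quadratic factor
  \<open>(t - u)\<^sup>2 + v\<^sup>2\<close> with \<open>v \<noteq> 0\<close> has a form bounded below by \<open>v\<^sup>2\<close>; products inherit the
  property.\<close>

lemma poly_op_bounded_below:
  assumes X: "selfadjoint_op X"
  shows "q \<noteq> 0 \<Longrightarrow> (\<And>t. t \<in> real_spectrum X \<Longrightarrow> poly q t \<noteq> 0) \<Longrightarrow> bounded_below (poly_op q X)"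
proof (induction "degree q" arbitrary: q rule: less_induct)
  case less
  show ?case
  proof (cases "degree q = 0")
    case True
    then obtain a where "q = [:a:]" "a \<noteq> 0"
      using less.prems by (metis degree_eq_zeroE pCons_0_0)
    then show ?thesis by (intro bounded_belowI[of "\<bar>a\<bar>"]) simp_all
  next
    case False
    have "\<exists>d. d dvd q \<and> degree d > 0 \<and> bounded_below (poly_op d X)"
    proof (rule real_poly_root_or_quadratic_factor[of q])
      show "degree q > 0" using False by simp
    next
      fix t assume t: "[:- t, 1:] dvd q"
      then have "t \<notin> real_spectrum X"
        using less.prems(2)[of t] by (auto simp: poly_eq_0_iff_dvd)
      then have "bounded_below (\<lambda>x. X x - t *\<^sub>R x)" by (simp add: real_spectrum_iff X)
      then have "bounded_below (poly_op [:- t, 1:] X)" by (simp add: bounded_below_def)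
      then show ?thesis using t by (intro exI[of _ "[:- t, 1:]"]) simp
    next
      fix u v :: real assume v: "v \<noteq> 0" and d: "[:u\<^sup>2 + v\<^sup>2, - 2 * u, 1:] dvd q"
      have "bounded_below (poly_op [:u\<^sup>2 + v\<^sup>2, - 2 * u, 1:] X)"
      proof (rule bounded_below_of_form)
        show "v\<^sup>2 * (norm x)\<^sup>2 \<le> inner (poly_op [:u\<^sup>2 + v\<^sup>2, - 2 * u, 1:] X x) x" for x
        proof -
          have "0 \<le> inner (X x - u *\<^sub>R x) (X x - u *\<^sub>R x)" by simp
          also have "\<dots> = inner (X (X x)) x - 2 * u * inner (X x) x + u\<^sup>2 * inner x x"
            using selfadjoint_inner[OF X, of "X x" x]
            by (simp add: inner_diff_left inner_diff_right inner_commute algebra_simps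
                power2_eq_square)
          finally show ?thesis
            by (simp add: blinfun.diff_right blinfun.scaleR_right inner_diff_left
                power2_norm_eq_inner algebra_simps)
        qed
      qed (use v in simp)
      then show ?thesis using d by (intro exI[of _ "[:u\<^sup>2 + v\<^sup>2, - 2 * u, 1:]"]) simp
    qed
    then obtain d r where d: "q = d * r" "degree d > 0" "bounded_below (poly_op d X)"
      by (auto elim: dvdE)
    have "r \<noteq> 0" "d \<noteq> 0" using less.prems(1) d(1) by auto
    then have "bounded_below (poly_op r X)"
      using d less.prems(2) by (intro less.hyps) (auto simp: degree_mult_eq)
    then show ?thesis
      using bounded_below_comp[OF d(3)] d(1) by (simp add: bounded_below_def)
  qed
qed

text \<open>Both \<open>p - a = 0\<close> and \<open>p - a \<noteq> 0\<close> lead to a point of the spectrum where \<open>p\<close> takes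
  the value \<open>a\<close>: in the first case any point will do, as the spectrum is nonempty.\<close>

lemma poly_op_nonneg:
  assumes X: "selfadjoint_op X" and p: "\<And>t. t \<in> real_spectrum X \<Longrightarrow> 0 \<le> poly p t"
  shows "0 \<le> inner (poly_op p X x) x"
proof (cases "x = 0")
  case False
  obtain a where a: "\<And>y. a * (norm y)\<^sup>2 \<le> inner (poly_op p X y) y"
      "\<not> bounded_below (\<lambda>y. poly_op p X y - a *\<^sub>R y)"
    using symmetric_form_infimum[of "poly_op p X" x] False
      selfadjoint_inner[OF selfadjoint_poly_op[OF X]] by metis
  have "\<not> bounded_below (poly_op (p - [:a:]) X)"
    using a(2) by (simp add: bounded_below_def)
  then have "\<exists>t\<in>real_spectrum X. poly (p - [:a:]) t = 0"
    using poly_op_bounded_below[OF X, of "p - [:a:]"] real_spectrum_nonempty[OF X False]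
    by (cases "p - [:a:] = 0") auto
  then have "0 \<le> a" using p by auto
  then have "0 \<le> a * (norm x)\<^sup>2" by simp
  also have "\<dots> \<le> inner (poly_op p X x) x" by (rule a(1))
  finally show ?thesis .
qed simp

text \<open>Positivity of \<open>e\<^sup>2 - p(X)\<^sup>2\<close> is the norm bound, as the form of \<open>p(X)\<^sup>2\<close> at \<open>x\<close> is the
  square of the norm of \<open>p(X) x\<close>.\<close>

lemma norm_poly_op_le:
  assumes X: "selfadjoint_op X" and "0 \<le> e" "\<And>t. t \<in> real_spectrum X \<Longrightarrow> \<bar>poly p t\<bar> \<le> e"
  shows "norm (poly_op p X) \<le> e"
proof (rule norm_blinfun_bound[OF \<open>0 \<le> e\<close>])
  fix x
  have "0 \<le> inner (poly_op ([:e\<^sup>2:] - p * p) X x) x"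
  proof (rule poly_op_nonneg[OF X])
    fix t assume "t \<in> real_spectrum X"
    then have "\<bar>poly p t\<bar>\<^sup>2 \<le> e\<^sup>2" by (intro power_mono assms) auto
    then show "0 \<le> poly ([:e\<^sup>2:] - p * p) t" by (simp add: power2_eq_square)
  qed
  then have "(norm (poly_op p X x))\<^sup>2 \<le> (e * norm x)\<^sup>2"
    using selfadjoint_inner[OF selfadjoint_poly_op[OF X], of p "poly_op p X x" x]
    by (simp add: inner_diff_left power2_norm_eq_inner power_mult_distrib)
  then show "norm (poly_op p X x) \<le> e * norm x"
    by (rule power2_le_imp_le) (use assms in simp)
qed

section \<open>The continuous functional calculus\<close>

lemma poly_approximation:
  fixes g :: "real \<Rightarrow> real"
  assumes "compact S" "continuous_on S g"
  obtains p where "uniform_limit S (\<lambda>n t. poly (p n) t) g sequentially"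
proof -
  obtain h where h: "uniform_limit S h g sequentially" "\<And>n::nat. polynomial_function (h n)"
    using Stone_Weierstrass_uniform_limit[OF assms] by blast
  have "\<exists>q. poly q = h n" for n
  proof -
    obtain a k where "h n = (\<lambda>x. \<Sum>i\<le>k. a i * x ^ i)"
      using h(2)[of n] by (auto simp: real_polynomial_function_eq[symmetric]
          real_polynomial_function_iff_sum)
    then have "poly (\<Sum>i\<le>k. monom (a i) i) = h n"
      by (simp add: fun_eq_iff poly_sum poly_monom)
    then show ?thesis by blast
  qed
  then obtain p where "\<And>n. poly (p n) = h n" by metis
  then show thesis using h(1) that[of p] by simp
qed

text \<open>Taking \<open>q = p\<close> this is the Cauchy property that gives the existence of \<open>f(X)\<close>; with different
  sequences it gives the independence of the approximation.\<close>

lemma poly_op_differences_small: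
  assumes X: "selfadjoint_op X"
    and p: "uniform_limit (real_spectrum X) (\<lambda>n t. poly (p n) t) g sequentially"
    and q: "uniform_limit (real_spectrum X) (\<lambda>n t. poly (q n) t) g sequentially"
    and e: "0 < e"
  shows "\<exists>N. \<forall>m\<ge>N. \<forall>n\<ge>N. norm (poly_op (p m) X - poly_op (q n) X) < e"
proof -
  have "\<forall>\<^sub>F n in sequentially. \<forall>t\<in>real_spectrum X.
      dist (poly (p n) t) (g t) < e / 3 \<and> dist (poly (q n) t) (g t) < e / 3"
    using uniform_limitD[OF p, of "e / 3"] uniform_limitD[OF q, of "e / 3"] e
    by (auto elim: eventually_elim2)
  then obtain N where N: "\<And>n t. n \<ge> N \<Longrightarrow> t \<in> real_spectrum X \<Longrightarrow>
      dist (poly (p n) t) (g t) < e / 3 \<and> dist (poly (q n) t) (g t) < e / 3"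
    unfolding eventually_sequentially by blast
  have "norm (poly_op (p m) X - poly_op (q n) X) < e" if mn: "m \<ge> N" "n \<ge> N" for m n
  proof -
    have "norm (poly_op (p m - q n) X) \<le> 2 * e / 3"
    proof (rule norm_poly_op_le[OF X])
      show "\<bar>poly (p m - q n) t\<bar> \<le> 2 * e / 3" if t: "t \<in> real_spectrum X" for t
        using conjunct1[OF N[OF mn(1) t]] conjunct2[OF N[OF mn(2) t]]
        unfolding dist_real_def poly_diff by linarith
    qed (use e in simp)
    moreover have "poly_op (p m - q n) X = poly_op (p m) X - poly_op (q n) X"
      by (rule blinfun_eqI) (simp add: blinfun.diff_left)
    ultimately show ?thesis using e by simp
  qed
  then show ?thesis by blast
qed

lemma cfc_eqI:
  assumes X: "selfadjoint_op X"
    and p: "uniform_limit (real_spectrum X) (\<lambda>n t. poly (p n) t) g sequentially"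
    and T: "(\<lambda>n. poly_op (p n) X) \<longlonglongrightarrow> T"
  shows "cfc g X = T"
  unfolding cfc_def real_spectrum_def[symmetric]
proof (rule the_equality)
  show "\<exists>p. uniform_limit (real_spectrum X) (\<lambda>n. poly (p n)) g sequentially \<and>
      (\<lambda>n. poly_op (p n) X) \<longlonglongrightarrow> T"
    using p T by blast
next
  fix U
  assume "\<exists>q. uniform_limit (real_spectrum X) (\<lambda>n. poly (q n)) g sequentially \<and>
      (\<lambda>n. poly_op (q n) X) \<longlonglongrightarrow> U"
  then obtain q where q: "uniform_limit (real_spectrum X) (\<lambda>n t. poly (q n) t) g sequentially"
    and U: "(\<lambda>n. poly_op (q n) X) \<longlonglongrightarrow> U" by blast
  have "(\<lambda>n. poly_op (p n) X - poly_op (q n) X) \<longlonglongrightarrow> 0"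
    using poly_op_differences_small[OF X p q] by (intro LIMSEQ_I) fastforce
  moreover have "(\<lambda>n. poly_op (p n) X - poly_op (q n) X) \<longlonglongrightarrow> T - U"
    by (intro tendsto_diff T U)
  ultimately show "U = T" using LIMSEQ_unique by fastforce
qed

lemma cfc_limit:
  assumes X: "selfadjoint_op X" and g: "continuous_on (real_spectrum X) g"
  obtains p where "uniform_limit (real_spectrum X) (\<lambda>n t. poly (p n) t) g sequentially"
    "(\<lambda>n. poly_op (p n) X) \<longlonglongrightarrow> cfc g X"
proof -
  obtain p where p: "uniform_limit (real_spectrum X) (\<lambda>n t. poly (p n) t) g sequentially"
    using poly_approximation[OF compact_real_spectrum[OF X] g] by blast
  have "Cauchy (\<lambda>n. poly_op (p n) X)"
    by (rule CauchyI) (rule poly_op_differences_small[OF X p p])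
  then obtain T where T: "(\<lambda>n. poly_op (p n) X) \<longlonglongrightarrow> T"
    using Cauchy_convergent convergent_def by blast
  show thesis using that[OF p] T cfc_eqI[OF X p T] by simp
qed

lemma selfadjoint_cfc:
  "selfadjoint_op X \<Longrightarrow> continuous_on (real_spectrum X) g \<Longrightarrow> selfadjoint_op (cfc g X)"
  by (metis cfc_limit selfadjoint_lim selfadjoint_poly_op)

lemma cfc_poly: "selfadjoint_op X \<Longrightarrow> cfc (poly p) X = poly_op p X"
  by (rule cfc_eqI[of _ "\<lambda>_. p"]) (auto intro: uniform_limit_const)

text \<open>Approximating polynomials satisfy \<open>p\<^sub>n \<le> q\<^sub>n + e\<close> on the spectrum from some index on, so the inequality
  passes to operators with an error \<open>e\<close>, which then tends to zero.\<close>

lemma cfc_mono: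
  assumes X: "selfadjoint_op X"
    and g: "continuous_on (real_spectrum X) g" and h: "continuous_on (real_spectrum X) h"
    and le: "\<And>t. t \<in> real_spectrum X \<Longrightarrow> g t \<le> h t"
  shows "inner (cfc g X x) x \<le> inner (cfc h X x) x"
proof -
  obtain p where p: "uniform_limit (real_spectrum X) (\<lambda>n t. poly (p n) t) g sequentially"
    "(\<lambda>n. poly_op (p n) X) \<longlonglongrightarrow> cfc g X" using cfc_limit[OF X g] by blast
  obtain q where q: "uniform_limit (real_spectrum X) (\<lambda>n t. poly (q n) t) h sequentially"
    "(\<lambda>n. poly_op (q n) X) \<longlonglongrightarrow> cfc h X" using cfc_limit[OF X h] by blast
  have lim: "(\<lambda>n. inner (poly_op (q n) X x) x - inner (poly_op (p n) X x) x)
      \<longlonglongrightarrow> inner (cfc h X x) x - inner (cfc g X x) x"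
    by (intro tendsto_diff tendsto_inner blinfun.tendsto p q tendsto_const)
  have "- (e * (norm x)\<^sup>2) \<le> inner (cfc h X x) x - inner (cfc g X x) x" if e: "0 < e" for e
  proof (rule tendsto_lowerbound[OF lim])
    have "\<forall>\<^sub>F n in sequentially. \<forall>t\<in>real_spectrum X.
        dist (poly (p n) t) (g t) < e / 2 \<and> dist (poly (q n) t) (h t) < e / 2"
      using uniform_limitD[OF p(1), of "e / 2"] uniform_limitD[OF q(1), of "e / 2"] e
      by (auto elim: eventually_elim2)
    then show "\<forall>\<^sub>F n in sequentially. - (e * (norm x)\<^sup>2)
        \<le> inner (poly_op (q n) X x) x - inner (poly_op (p n) X x) x"
    proof eventually_elim
      case (elim n)
      have "0 \<le> inner (poly_op (q n - p n + [:e:]) X x) x"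
      proof (rule poly_op_nonneg[OF X])
        fix t assume t: "t \<in> real_spectrum X"
        then have "\<bar>poly (p n) t - g t\<bar> < e / 2" "\<bar>poly (q n) t - h t\<bar> < e / 2"
          using elim by (simp_all add: dist_real_def)
        then show "0 \<le> poly (q n - p n + [:e:]) t"
          using le[OF t] by (simp add: abs_if split: if_splits)
      qed
      then show ?case
        by (simp add: inner_add_left inner_diff_left power2_norm_eq_inner)
    qed
  qed simp
  then have *: "inner (cfc g X x) x - inner (cfc h X x) x \<le> e * (norm x)\<^sup>2" if "0 < e" for e
    using that by (simp add: algebra_simps)
  have "inner (cfc g X x) x - inner (cfc h X x) x \<le> 0"
  proof (rule tendsto_lowerbound)
    show "((\<lambda>e. e * (norm x)\<^sup>2) \<longlongrightarrow> 0) (at_right 0)"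
      by (auto intro!: tendsto_eq_intros)
    show "\<forall>\<^sub>F e in at_right 0. inner (cfc g X x) x - inner (cfc h X x) x \<le> e * (norm x)\<^sup>2"
      using * by (auto simp: eventually_at_filter)
  qed simp
  then show ?thesis by simp
qed

section \<open>The refined chord of a log-convex function\<close>

lemma convex_on_chord_le:
  fixes \<phi> :: "real \<Rightarrow> real"
  assumes "convex_on J \<phi>" "a \<in> J" "b \<in> J" "a < b" "t \<in> {a..b}"
  shows "\<phi> t \<le> (b - t) / (b - a) * \<phi> a + (t - a) / (b - a) * \<phi> b"
proof -
  define l where "l = (t - a) / (b - a)"
  have l: "0 \<le> l" "0 \<le> 1 - l" "1 - l = (b - t) / (b - a)"
    using assms by (auto simp: l_def field_simps)
  have "l * (b - a) = t - a" using assms by (simp add: l_def)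
  then have "(1 - l) * a + l * b = t" by (simp add: algebra_simps)
  then show ?thesis
    using convex_onD[OF assms(1) _ _ assms(2,3), of l] l by (simp add: l_def)
qed

text \<open>For \<open>t\<close> outside the interval, the endpoint nearer to \<open>t\<close> lies between \<open>t\<close> and the other
  endpoint; the chord inequality at that point is solved for the value at \<open>t\<close>.\<close>

lemma convex_on_extrapolation_le:
  fixes \<phi> :: "real \<Rightarrow> real"
  assumes cv: "convex_on J \<phi>" and J: "a \<in> J" "b \<in> J" "t \<in> J" and ab: "a < b" and t: "t \<notin> {a<..<b}"
  shows "(b - t) / (b - a) * \<phi> a + (t - a) / (b - a) * \<phi> b \<le> \<phi> t"
proof -
  consider "t = a" | "t = b" | "t < a" | "b < t" using t by force
  then show ?thesis
  proof cases
    case 3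
    have "\<phi> a \<le> (b - a) / (b - t) * \<phi> t + (a - t) / (b - t) * \<phi> b"
      using convex_on_chord_le[OF cv J(3,2), of a] 3 ab by simp
    then have "\<phi> a \<le> ((b - a) * \<phi> t + (a - t) * \<phi> b) / (b - t)"
      by (simp add: add_divide_distrib)
    then have "\<phi> a * (b - t) \<le> (b - a) * \<phi> t + (a - t) * \<phi> b"
      using 3 ab by (simp add: pos_le_divide_eq)
    then have "((b - t) * \<phi> a + (t - a) * \<phi> b) / (b - a) \<le> \<phi> t"
      using ab by (simp add: pos_divide_le_eq algebra_simps)
    then show ?thesis by (simp add: add_divide_distrib)
  next
    case 4
    have "\<phi> b \<le> (t - b) / (t - a) * \<phi> a + (b - a) / (t - a) * \<phi> t"
      using convex_on_chord_le[OF cv J(1,3), of b] 4 ab by simp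
    then have "\<phi> b \<le> ((t - b) * \<phi> a + (b - a) * \<phi> t) / (t - a)"
      by (simp add: add_divide_distrib)
    then have "\<phi> b * (t - a) \<le> (t - b) * \<phi> a + (b - a) * \<phi> t"
      using 4 ab by (simp add: pos_le_divide_eq)
    then have "((b - t) * \<phi> a + (t - a) * \<phi> b) / (b - a) \<le> \<phi> t"
      using ab by (simp add: pos_divide_le_eq algebra_simps)
    then show ?thesis by (simp add: add_divide_distrib)
  qed (use ab in auto)
qed

abbreviation chord :: "(real \<Rightarrow> real) \<Rightarrow> real \<Rightarrow> real \<Rightarrow> real \<Rightarrow> real" where
  "chord f m M t \<equiv> (M - t) / (M - m) * f m + (t - m) / (M - m) * f M"

context
  fixes J :: "real set" and f :: "real \<Rightarrow> real" and m M :: real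
  assumes lc: "log_convex_on J f" and mJ: "m \<in> J" and MJ: "M \<in> J" and mM: "m < M"
begin

lemma between_mem:
  assumes "t \<in> {m..M}"
  shows "t \<in> J"
proof -
  have "is_interval J"
    using lc by (simp add: log_convex_on_def convex_on_def is_interval_convex_1)
  then show ?thesis
    using mem_is_interval_1_I[of J m M t] mJ MJ assms by simp
qed

lemma midpoint_mem: "(m + M) / 2 \<in> J"
  using mM by (intro between_mem) simp

lemma values_pos: "0 < f m" "0 < f M" "0 < f ((m + M) / 2)"
  using lc mJ MJ midpoint_mem by (auto simp: log_convex_on_def)

lemma ln_convex: "convex_on J (\<lambda>x. ln (f x))"
  using lc by (simp add: log_convex_on_def)

lemma refined_chord_pos: "0 < refined_chord f m M t"
  using values_pos by (simp add: refined_chord_def kant_def)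

lemma ln_refined_chord:
  "ln (refined_chord f m M t) = tilde m M t * (2 * ln (f ((m + M) / 2)) - ln (f m) - ln (f M))
     + chord (\<lambda>x. ln (f x)) m M t"
  using values_pos by (simp add: refined_chord_def kant_def ln_mult ln_div ln_realpow ln_powr)

text \<open>To the left of the midpoint \<open>tilde m M t\<close> is the linear function \<open>(t - m) / (M - m)\<close>, and
  the factor \<open>K\<close> exchanges the value at \<open>M\<close> in the chord of \<open>ln f\<close> for the value at the midpoint.\<close>

lemma ln_refined_chord_left:
  assumes "t \<le> (m + M) / 2"
  shows "ln (refined_chord f m M t) = chord (\<lambda>x. ln (f x)) m ((m + M) / 2) t"
proof -
  define r where "r = (t - m) / (M - m)"
  have "tilde m M t = r" "(M - t) / (M - m) = 1 - r" "(t - m) / ((m + M) / 2 - m) = 2 * r"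
    "((m + M) / 2 - t) / ((m + M) / 2 - m) = 1 - 2 * r"
    using assms mM by (simp_all add: r_def tilde_def field_simps)
  then show ?thesis
    unfolding ln_refined_chord by (simp flip: r_def) (simp add: algebra_simps)
qed

lemma ln_refined_chord_right:
  assumes "(m + M) / 2 \<le> t"
  shows "ln (refined_chord f m M t) = chord (\<lambda>x. ln (f x)) ((m + M) / 2) M t"
proof -
  define r where "r = (M - t) / (M - m)"
  have "tilde m M t = r" "(t - m) / (M - m) = 1 - r" "(M - t) / (M - (m + M) / 2) = 2 * r"
    "(t - (m + M) / 2) / (M - (m + M) / 2) = 1 - 2 * r"
    using assms mM by (simp_all add: r_def tilde_def field_simps)
  then show ?thesis
    unfolding ln_refined_chord by (simp flip: r_def) (simp add: algebra_simps)
qed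

lemma le_refined_chord:
  assumes t: "t \<in> {m..M}"
  shows "f t \<le> refined_chord f m M t"
proof -
  have "t \<in> J" using t by (rule between_mem)
  then have "0 < f t" using lc by (auto simp: log_convex_on_def)
  moreover have "ln (f t) \<le> ln (refined_chord f m M t)"
  proof (cases "t \<le> (m + M) / 2")
    case True
    then show ?thesis unfolding ln_refined_chord_left[OF True]
      using t mM by (intro convex_on_chord_le[OF ln_convex mJ midpoint_mem]) auto
  next
    case False
    then have le: "(m + M) / 2 \<le> t" by simp
    then show ?thesis unfolding ln_refined_chord_right[OF le]
      using t mM by (intro convex_on_chord_le[OF ln_convex midpoint_mem MJ]) auto
  qed
  ultimately show ?thesis using refined_chord_pos by simp
qed

lemma refined_chord_le:
  assumes t: "t \<in> J" "t \<notin> {m<..<M}"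
  shows "refined_chord f m M t \<le> f t"
proof -
  have "0 < f t" using lc t by (auto simp: log_convex_on_def)
  moreover have "ln (refined_chord f m M t) \<le> ln (f t)"
  proof (cases "t \<le> (m + M) / 2")
    case True
    then show ?thesis unfolding ln_refined_chord_left[OF True]
      using t mM by (intro convex_on_extrapolation_le[OF ln_convex mJ midpoint_mem]) auto
  next
    case False
    then have le: "(m + M) / 2 \<le> t" by simp
    then show ?thesis unfolding ln_refined_chord_right[OF le]
      using t mM by (intro convex_on_extrapolation_le[OF ln_convex midpoint_mem MJ]) auto
  qed
  ultimately show ?thesis using refined_chord_pos by simp
qed

lemma convex_geometric_chord: "convex_on UNIV (\<lambda>t. exp (chord (\<lambda>x. ln (f x)) m M t))"
proof (rule convex_onI)
  fix l x y :: real assume l: "0 < l" "l < 1"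
  let ?c = "chord (\<lambda>x. ln (f x)) m M"
  have "?c ((1 - l) *\<^sub>R x + l *\<^sub>R y) = (1 - l) *\<^sub>R ?c x + l *\<^sub>R ?c y"
    by (simp add: divide_inverse algebra_simps)
  then show "exp (?c ((1 - l) *\<^sub>R x + l *\<^sub>R y)) \<le> (1 - l) * exp (?c x) + l * exp (?c y)"
    using convex_onD[OF exp_convex, of l "?c x" "?c y"] l by (simp del: exp_le_cancel_iff)
qed simp

text \<open>This is \<open>ln K \<le> 0\<close>, the midpoint convexity of \<open>ln f\<close>.\<close>

lemma midpoint_defect_nonpos: "2 * ln (f ((m + M) / 2)) - ln (f m) - ln (f M) \<le> 0"
proof -
  have "(M - (m + M) / 2) / (M - m) = 1 / 2" "((m + M) / 2 - m) / (M - m) = 1 / 2"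
    using mM by (simp_all add: field_simps)
  then show ?thesis
    using convex_on_chord_le[OF ln_convex mJ MJ mM, of "(m + M) / 2"] mM
    by (simp only: atLeastAtMost_iff) (simp add: field_simps)
qed

text \<open>Between \<open>R\<close> and the chord lies the weighted geometric mean of \<open>f m\<close> and \<open>f M\<close>: the
  weight of \<open>ln K \<le> 0\<close> is nonnegative here, and the convex function \<open>exp\<close> of a line lies below its chord.
  Outside the interval both comparisons turn round.\<close>

lemma refined_chord_le_chord:
  assumes t: "t \<in> {m..M}"
  shows "refined_chord f m M t \<le> chord f m M t"
proof -
  have "\<bar>t - (m + M) / 2\<bar> \<le> (M - m) / 2"
    using t by (auto simp: abs_if field_simps)
  then have "0 \<le> tilde m M t"
    using mM by (simp add: tilde_def pos_divide_le_eq)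
  then have "ln (refined_chord f m M t) \<le> chord (\<lambda>x. ln (f x)) m M t"
    unfolding ln_refined_chord using midpoint_defect_nonpos by (simp add: mult_nonneg_nonpos)
  then have "refined_chord f m M t \<le> exp (chord (\<lambda>x. ln (f x)) m M t)"
    using exp_ln[OF refined_chord_pos, of t] by (metis exp_le_cancel_iff)
  also have "\<dots> \<le> chord f m M t"
    using convex_on_chord_le[OF convex_geometric_chord _ _ mM t] mM values_pos by simp
  finally show ?thesis .
qed

lemma chord_le_refined_chord:
  assumes t: "t \<notin> {m<..<M}"
  shows "chord f m M t \<le> refined_chord f m M t"
proof -
  have "tilde m M t \<le> 0" using t mM by (auto simp: tilde_def field_simps abs_if)
  then have "chord (\<lambda>x. ln (f x)) m M t \<le> ln (refined_chord f m M t)"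
    unfolding ln_refined_chord using midpoint_defect_nonpos by (simp add: mult_nonpos_nonpos)
  then have "exp (chord (\<lambda>x. ln (f x)) m M t) \<le> refined_chord f m M t"
    using refined_chord_pos by (simp add: ln_ge_iff)
  moreover have "chord f m M t \<le> exp (chord (\<lambda>x. ln (f x)) m M t)"
    using convex_on_extrapolation_le[OF convex_geometric_chord _ _ _ mM t] mM values_pos by simp
  ultimately show ?thesis by linarith
qed

lemma continuous_refined_chord: "continuous_on S (refined_chord f m M)"
  unfolding refined_chord_def tilde_def kant_def
  using values_pos mM by (auto intro!: continuous_intros)

end

section \<open>The operator inequalities\<close>

theorem theorem2p3:
  fixes A B C D :: "'a::complex_hilbert \<Rightarrow>\<^sub>L 'a"
    and J :: "real set" and f :: "real \<Rightarrow> real" and m M :: real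
  assumes "is_interval J"
    and "continuous_on J f"
    and "log_convex_on J f"
    and "selfadjoint_op A" and "selfadjoint_op B" and "selfadjoint_op C" and "selfadjoint_op D"
    and "spectrum_op A \<subseteq> complex_of_real ` J" and "spectrum_op B \<subseteq> complex_of_real ` J"
    and "spectrum_op C \<subseteq> complex_of_real ` J" and "spectrum_op D \<subseteq> complex_of_real ` J"
    and "m < M"
    and "A \<preceq> scalar_op m" and "scalar_op m \<preceq> B" and "B \<preceq> scalar_op M" and "scalar_op M \<preceq> D"
    and "scalar_op m \<preceq> C" and "C \<preceq> scalar_op M"
    and "(B + C \<preceq> A + D \<and> f m \<le> f M) \<or> (A + D \<preceq> B + C \<and> f M \<le> f m)"
  shows "cfc f B + cfc f C \<preceq> cfc (refined_chord f m M) B + cfc (refined_chord f m M) C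
    \<and> cfc (refined_chord f m M) B + cfc (refined_chord f m M) C
        \<preceq> (f m / (M - m)) *\<^sub>R (scalar_op (2 * M) - B - C)
          + (f M / (M - m)) *\<^sub>R (B + C - scalar_op (2 * m))
    \<and> (f m / (M - m)) *\<^sub>R (scalar_op (2 * M) - B - C)
          + (f M / (M - m)) *\<^sub>R (B + C - scalar_op (2 * m))
        \<preceq> cfc (refined_chord f m M) A + cfc (refined_chord f m M) D
    \<and> cfc (refined_chord f m M) A + cfc (refined_chord f m M) D \<preceq> cfc f A + cfc f D"
proof (cases "\<exists>x::'a. x \<noteq> 0")
  case False
  \<comment> \<open>on the zero space the spectrum may be empty, but there every operator is positive\<close>
  then have all0: "x = 0" for x :: 'a by blast
  have "positive_op Z" for Z :: "'a \<Rightarrow>\<^sub>L 'a"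
  proof -
    have "cinner (Z u) v = cinner u (Z v)" for u v
      using all0[of u] all0[of v] all0[of "Z u"] all0[of "Z v"] by simp
    then have "selfadjoint_op Z" by (simp add: selfadjoint_iff_cinner)
    moreover have "inner (Z x) x = 0" for x using all0[of x] by simp
    ultimately show ?thesis by (simp add: positive_op_iff)
  qed
  then show ?thesis by (simp add: op_le_def)
next
  case True
  then obtain x0 :: 'a where x0: "x0 \<noteq> 0" by blast
  let ?R = "refined_chord f m M"
  define k where "k = (f M - f m) / (M - m)"
  define c where "c = (M * f m - m * f M) / (M - m)"
  define l where "l = [:c, k:]"
  have l: "poly l t = chord f m M t" for t
    using \<open>m < M\<close> by (simp add: l_def c_def k_def divide_simps) (simp add: algebra_simps)
  note sa = \<open>selfadjoint_op A\<close> \<open>selfadjoint_op B\<close> \<open>selfadjoint_op C\<close> \<open>selfadjoint_op D\<close>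
  have J: "real_spectrum A \<subseteq> J" "real_spectrum B \<subseteq> J" "real_spectrum C \<subseteq> J" "real_spectrum D \<subseteq> J"
    using assms(8-11) by (auto simp: real_spectrum_def)
  \<comment> \<open>spectral points of \<open>A\<close> and \<open>D\<close> enclose \<open>m\<close> and \<open>M\<close> between two points of the interval \<open>J\<close>\<close>
  obtain a where "a \<in> real_spectrum A" using real_spectrum_nonempty[OF sa(1) x0] by blast
  then have a: "a \<in> J" "a \<le> m" using J real_spectrum_le[OF sa(1)] assms by auto
  obtain d where "d \<in> real_spectrum D" using real_spectrum_nonempty[OF sa(4) x0] by blast
  then have d: "d \<in> J" "M \<le> d" using J real_spectrum_ge[OF sa(4)] assms by auto
  have mJ: "m \<in> J" and MJ: "M \<in> J"
    using a d \<open>m < M\<close> \<open>is_interval J\<close> mem_is_interval_1_I[of J a d] by auto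
  note scalar = assms(3) mJ MJ \<open>m < M\<close>
  have inside: "real_spectrum B \<subseteq> {m..M}" "real_spectrum C \<subseteq> {m..M}"
    using real_spectrum_ge[OF sa(2) assms(14)] real_spectrum_le[OF sa(2) assms(15)]
      real_spectrum_ge[OF sa(3) assms(17)] real_spectrum_le[OF sa(3) assms(18)] by auto
  have outside: "t \<notin> {m<..<M}" if "t \<in> real_spectrum A \<union> real_spectrum D" for t
    using that real_spectrum_le[OF sa(1) assms(13)] real_spectrum_ge[OF sa(4) assms(16)] by force
  have cf: "continuous_on (real_spectrum X) f" if "real_spectrum X \<subseteq> J" for X :: "'a \<Rightarrow>\<^sub>L 'a"
    using assms(2) that by (rule continuous_on_subset)
  note cR = continuous_refined_chord[OF scalar]
  have cl: "continuous_on S (poly l)" for S by (intro continuous_intros)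
  note saf = selfadjoint_cfc[OF sa(1) cf[OF J(1)]] selfadjoint_cfc[OF sa(2) cf[OF J(2)]]
    selfadjoint_cfc[OF sa(3) cf[OF J(3)]] selfadjoint_cfc[OF sa(4) cf[OF J(4)]]
  note saR = sa[THEN selfadjoint_cfc[OF _ cR]]
  define E where "E = (f m / (M - m)) *\<^sub>R (scalar_op (2 * M) - B - C)
          + (f M / (M - m)) *\<^sub>R (B + C - scalar_op (2 * m))"
  have saE: "selfadjoint_op E"
    unfolding E_def by (intro selfadjoint_add selfadjoint_scaleR selfadjoint_diff
      selfadjoint_scalar_op sa)
  have form: "inner (cfc (poly l) X x) x = c * inner x x + k * inner (X x) x"
    if "selfadjoint_op X" for X x
    using that by (simp add: cfc_poly l_def inner_add_left blinfun.scaleR_right)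
  have E: "inner (E x) x = inner (cfc (poly l) B x) x + inner (cfc (poly l) C x) x" for x
    using \<open>m < M\<close>
    by (simp add: form sa E_def c_def k_def blinfun.add_left blinfun.diff_left blinfun.scaleR_left
        inner_add_left inner_diff_left divide_simps) (simp add: algebra_simps)
  have 1: "inner (cfc f X x) x \<le> inner (cfc ?R X x) x"
      and 2: "inner (cfc ?R X x) x \<le> inner (cfc (poly l) X x) x"
    if "X = B \<or> X = C" for X x
    using that inside J le_refined_chord[OF scalar] refined_chord_le_chord[OF scalar]
    by (auto intro!: cfc_mono sa cf cR cl simp: l simp del: atLeastAtMost_iff)
  have 3: "inner (cfc (poly l) X x) x \<le> inner (cfc ?R X x) x"
      and 4: "inner (cfc ?R X x) x \<le> inner (cfc f X x) x"
    if "X = A \<or> X = D" for X x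
    using that outside J refined_chord_le[OF scalar] chord_le_refined_chord[OF scalar]
    by (auto intro!: cfc_mono sa cf cR cl simp: l simp del: greaterThanLessThan_iff)
  have mid: "inner (cfc (poly l) B x) x + inner (cfc (poly l) C x) x
      \<le> inner (cfc (poly l) A x) x + inner (cfc (poly l) D x) x" for x
  proof -
    define s where "s = inner (A x) x + inner (D x) x - inner (B x) x - inner (C x) x"
    have "(0 \<le> s \<and> f m \<le> f M) \<or> (s \<le> 0 \<and> f M \<le> f m)"
      using assms(19) by (auto simp: op_le_iff sa selfadjoint_add blinfun.add_left inner_add_left
          s_def dest: spec[of _ x])
    then have "0 \<le> (f M - f m) * s"
      by (auto intro: mult_nonneg_nonneg mult_nonpos_nonpos)
    then have "0 \<le> k * s"
      using \<open>m < M\<close> by (simp add: k_def)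
    also have "\<dots> = inner (cfc (poly l) A x) x + inner (cfc (poly l) D x) x
        - inner (cfc (poly l) B x) x - inner (cfc (poly l) C x) x"
      by (simp add: form sa s_def algebra_simps)
    finally show ?thesis by simp
  qed
  show ?thesis
    unfolding E_def[symmetric]
  proof (intro conjI)
    note rules = op_le_iff selfadjoint_add saf saR saE blinfun.add_left inner_add_left E
    show "cfc f B + cfc f C \<preceq> cfc ?R B + cfc ?R C"
      using 1[of B] 1[of C] by (simp add: rules add_mono)
    show "cfc ?R B + cfc ?R C \<preceq> E"
      using 2[of B] 2[of C] by (simp add: rules add_mono)
    show "E \<preceq> cfc ?R A + cfc ?R D"
    proof -
      have "inner (E x) x \<le> inner (cfc ?R A x) x + inner (cfc ?R D x) x" for x
        using mid[of x] 3[of A x] 3[of D x] unfolding E by simp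
      then show ?thesis by (simp add: rules)
    qed
    show "cfc ?R A + cfc ?R D \<preceq> cfc f A + cfc f D"
      using 4[of A] 4[of D] by (simp add: rules add_mono)
  qed
qed

end
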